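(* Let $\lambda=e^{i\pi/3}$. Then for every integer $n\ge 3$, $$\ell_{\mathcal I}([A_\lambda])\ge 4.$$ Consequently, $\ell_{\mathcal I}(\mathrm{PU}(n,1))\ge 4$.
   Context: Let $V=\mathbb C^{n+1}$ be endowed with a nondegenerate Hermitian form $\langle\cdot,\cdot\rangle$ of signature $(n,1)$ ($n$ positive directions, one negative direction). Let $\mathrm U(n,1)$ be the group of linear automorphisms of $V$ preserving this form, $\mathrm{PU}(n,1)=\mathrm U(n,1)/\{e^{i\theta}\mathrm I:\theta\in\mathbb R\}$, and $[A]$ the class of $A\in\mathrm U(n,1)$ in $\mathrm{PU}(n,1)$. Fix $p\in V$ with $\langle p,p\rangle<0$, let $P_p$ be the Hermitian orthogonal projection of $V$ onto $\mathbb C p$, and for $\lambda\in\mathbb C$ with $|\lambda|=1$ let $A_\lambda=\lambda\,\mathrm I+(1-\lambda)P_p\in\mathrm U(n,1)$ (so $A_\lambda$ is $\lambda\,\mathrm I$ on $p^\perp$ and the identity on $\mathbb C p$). A holomorphic involution is an element of $\mathcal I=\{I\in\mathrm{PU}(n,1): I^2=1,\ I\ne 1\}$. For $g\in\mathrm{PU}(n,1)$ put $$\ell_{\mathcal I}(g)=\min\{k\ge 0: g=I_1\cdots I_k,\ I_j\in\mathcal I\},$$ where the identity has length $0$ (empty product) and the value is $+\infty$ if no such $k$ exists, and $\ell_{\mathcal I}(\mathrm{PU}(n,1))=\sup_{g\in\mathrm{PU}(n,1)}\ell_{\mathcal I}(g)$. *)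

theory Defs
  imports "HOL-Analysis.Analysis" "HOL-Algebra.Coset" "HOL-Library.Extended_Nat"
begin

text \<open>Hermitian forms are linear in the first argument and conjugate-linear in the second.\<close>

definition hermitian_form :: "(complex ^ 'm \<Rightarrow> complex ^ 'm \<Rightarrow> complex) \<Rightarrow> bool" where
  "hermitian_form h \<longleftrightarrow>
     (\<forall>u v w. h (u + v) w = h u w + h v w) \<and>
     (\<forall>c u w. h (c *s u) w = c * h u w) \<and>
     (\<forall>u v. h v u = cnj (h u v))"

definition nondegenerate_form :: "(complex ^ 'm \<Rightarrow> complex ^ 'm \<Rightarrow> complex) \<Rightarrow> bool" where
  "nondegenerate_form h \<longleftrightarrow> (\<forall>u. (\<forall>v. h u v = 0) \<longrightarrow> u = 0)"

text \<open>The values \<open>h b b\<close> of a Hermitian form are real, so their sign is that of \<open>Re (h b b)\<close>.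
  By Sylvester's law of inertia the counts do not depend on the orthogonal basis.\<close>

definition has_signature ::
    "(complex ^ 'm \<Rightarrow> complex ^ 'm \<Rightarrow> complex) \<Rightarrow> nat \<Rightarrow> nat \<Rightarrow> bool" where
  "has_signature h r s \<longleftrightarrow>
     (\<exists>B. vec.independent B \<and> vec.span B = UNIV \<and>
          (\<forall>b\<in>B. \<forall>c\<in>B. b \<noteq> c \<longrightarrow> h b c = 0) \<and>
          card {b \<in> B. Re (h b b) > 0} = r \<and>
          card {b \<in> B. Re (h b b) < 0} = s)"

definition unitary_group ::
    "(complex ^ 'm \<Rightarrow> complex ^ 'm \<Rightarrow> complex) \<Rightarrow> (complex ^ 'm \<Rightarrow> complex ^ 'm) monoid" where
  "unitary_group h =
     \<lparr>carrier = {A. Vector_Spaces.linear (*s) (*s) A \<and> bij A \<and> (\<forall>u v. h (A u) (A v) = h u v)},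
      mult = (\<circ>), one = id\<rparr>"

definition unit_scalars :: "(complex ^ 'm \<Rightarrow> complex ^ 'm) set" where
  "unit_scalars = {(\<lambda>v. exp (\<i> * of_real \<theta>) *s v) | \<theta>. True}"

definition projective_unitary_group ::
    "(complex ^ 'm \<Rightarrow> complex ^ 'm \<Rightarrow> complex) \<Rightarrow> (complex ^ 'm \<Rightarrow> complex ^ 'm) set monoid" where
  "projective_unitary_group h = unitary_group h Mod unit_scalars"

definition proj_class ::
    "(complex ^ 'm \<Rightarrow> complex ^ 'm \<Rightarrow> complex) \<Rightarrow> (complex ^ 'm \<Rightarrow> complex ^ 'm)
       \<Rightarrow> (complex ^ 'm \<Rightarrow> complex ^ 'm) set" where
  "proj_class h A = unit_scalars #>\<^bsub>unitary_group h\<^esub> A"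

definition line_projection ::
    "(complex ^ 'm \<Rightarrow> complex ^ 'm \<Rightarrow> complex) \<Rightarrow> complex ^ 'm \<Rightarrow> complex ^ 'm \<Rightarrow> complex ^ 'm" where
  "line_projection h p v = (h v p / h p p) *s p"

definition A_map ::
    "(complex ^ 'm \<Rightarrow> complex ^ 'm \<Rightarrow> complex) \<Rightarrow> complex ^ 'm \<Rightarrow> complex
       \<Rightarrow> complex ^ 'm \<Rightarrow> complex ^ 'm" where
  "A_map h p \<zeta> v = \<zeta> *s v + (1 - \<zeta>) *s line_projection h p v"

definition involutions :: "('g, 'b) monoid_scheme \<Rightarrow> 'g set" where
  "involutions G = {x \<in> carrier G. x \<otimes>\<^bsub>G\<^esub> x = \<one>\<^bsub>G\<^esub> \<and> x \<noteq> \<one>\<^bsub>G\<^esub>}"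

text \<open>In \<^typ>\<open>enat\<close>, the infimum of a nonempty set is its minimum and that of the empty set is \<open>\<infinity>\<close>.\<close>

definition involution_length :: "('g, 'b) monoid_scheme \<Rightarrow> 'g \<Rightarrow> enat" where
  "involution_length G g =
     Inf {enat (length xs) | xs.
            set xs \<subseteq> involutions G \<and> g = foldr (\<lambda>x y. x \<otimes>\<^bsub>G\<^esub> y) xs \<one>\<^bsub>G\<^esub>}"

definition group_involution_length :: "('g, 'b) monoid_scheme \<Rightarrow> enat" where
  "group_involution_length G = (SUP g\<in>carrier G. involution_length G g)"

end

theory Submission imports Defs begin

text \<open>
  Let \<open>A = A_map h p \<zeta>\<close> be the unitary map that fixes a negative vector \<open>p\<close> and is multiplication by
  \<open>\<zeta>\<close> on the hyperplane orthogonal to \<open>p\<close>. In dimension at least four the class of \<open>A\<close> has involution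
  length at least \<open>4\<close> as soon as \<open>\<zeta> ^ 4 \<noteq> 1\<close>, and \<open>exp (\<i> * pi / 3)\<close> satisfies this.

  An involution of the projective group lifts to a unitary map whose square is a scalar of modulus
  one; dividing by a square root of that scalar gives a lift with square the identity. A word of at
  most three involutions can be padded by identities, so a word representing the class of \<open>A\<close> gives
  \<open>U1 U2 U3 = \<mu> A\<close> with \<open>cmod \<mu> = 1\<close> and each \<open>U_j\<close> unitary with square the identity. Put
  \<open>M = U1 U2 = \<mu> A U3\<close>.

  Let \<open>T\<close> be the subspace orthogonal to \<open>p\<close> and \<open>U3 p\<close>. It is invariant under \<open>U3\<close>, and \<open>A\<close> is the
  scalar \<open>\<zeta>\<close> on it, so \<open>M\<^sup>2\<close> is the scalar \<open>c = (\<mu> \<zeta>)\<^sup>2\<close> on \<open>T\<close>. Since \<open>U1\<close> conjugates \<open>M\<close> into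
  its inverse, \<open>M\<^sup>2\<close> is the scalar \<open>cnj c\<close> on \<open>U1 T\<close>. If \<open>c\<^sup>2 \<noteq> 1\<close>, then these two spaces are
  orthogonal and meet only in zero. Each has codimension at most two, so in dimension at least four
  their sum is everything. But the form is nonnegative on \<open>T\<close>, which is orthogonal to the negative
  vector \<open>p\<close>, hence also on its isometric image \<open>U1 T\<close> and on the orthogonal sum of the two; this
  contradicts \<open>h p p < 0\<close>. Therefore \<open>(\<mu> \<zeta>) ^ 4 = 1\<close>
  (\<open>three_involutions_scalar_fourth_power\<close>).

  The determinant rules out this remaining case. With \<open>N\<close> the dimension, \<open>\<mu> A\<close> has determinant
  \<open>(\<mu> \<zeta>) ^ (N - 1) * \<mu>\<close>, which is \<open>1\<close> or \<open>-1\<close>. Its fourth power is therefore \<open>1\<close>, whence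
  \<open>\<mu> ^ 4 = 1\<close> and so \<open>\<zeta> ^ 4 = 1\<close>.
\<close>

lemma linear_vecI:
  fixes f :: "'a::field ^ 'n \<Rightarrow> 'a ^ 'k"
  assumes "\<And>x y. f (x + y) = f x + f y" "\<And>c x. f (c *s x) = c *s f x"
  shows "Vector_Spaces.linear (*s) (*s) f"
  by unfold_locales (simp_all add: assms)

section \<open>Hermitian forms with one negative direction\<close>

context
  fixes h :: "complex ^ 'm \<Rightarrow> complex ^ 'm \<Rightarrow> complex"
  assumes herm: "hermitian_form h"
begin

lemma form_sym: "h v u = cnj (h u v)"
  using herm unfolding hermitian_form_def by blast

lemma form_add_left: "h (u + v) w = h u w + h v w"
  using herm unfolding hermitian_form_def by blast

lemma form_scale_left: "h (c *s u) w = c * h u w"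
  using herm unfolding hermitian_form_def by blast

lemma form_add_right: "h w (u + v) = h w u + h w v"
  using form_sym[of w "u + v"] form_sym[of w u] form_sym[of w v] by (simp add: form_add_left)

lemma form_scale_right: "h w (c *s u) = cnj c * h w u"
  using form_sym[of w "c *s u"] form_sym[of w u] by (simp add: form_scale_left)

lemmas form_simps = form_add_left form_add_right form_scale_left form_scale_right

lemma form_zero_left: "h 0 w = 0"
  using form_scale_left[of 0 0 w] by simp

lemma form_diff_left: "h (u - v) w = h u w - h v w"
  using form_add_left[of "u - v" v w] by simp

lemma form_diff_right: "h w (u - v) = h w u - h w v"
  using form_add_right[of w "u - v" v] by simp

lemma form_sum_left: "h (\<Sum>b\<in>B. f b) w = (\<Sum>b\<in>B. h (f b) w)"
  by (induction B rule: infinite_finite_induct) (auto simp: form_zero_left form_add_left)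

lemma form_self_real: "cnj (h v v) = h v v"
  using form_sym[of v v] by simp

lemma subspace_form_kernel:
  assumes "vec.subspace S"
  shows "vec.subspace {v \<in> S. h v w = 0}"
  using assms by (auto simp: vec.subspace_def form_zero_left form_add_left form_scale_left)

lemma dim_form_kernel:
  assumes "vec.subspace S"
  shows "vec.dim S \<le> vec.dim {v \<in> S. h v w = 0} + 1"
proof (cases "\<exists>x\<in>S. h x w \<noteq> 0")
  case False
  then have "{v \<in> S. h v w = 0} = S" by auto
  then show ?thesis by simp
next
  case True
  then obtain x where x: "x \<in> S" "h x w \<noteq> 0" by blast
  let ?K = "{v \<in> S. h v w = 0}"
  have "S \<subseteq> vec.span (insert x ?K)"
  proof
    fix v assume v: "v \<in> S"
    have "v - (h v w / h x w) *s x \<in> ?K"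
      using v x assms
      by (auto simp: form_diff_left form_scale_left vec.subspace_diff vec.subspace_scale)
    then show "v \<in> vec.span (insert x ?K)"
      unfolding vec.span_insert by (auto intro: vec.span_base)
  qed
  then have "vec.dim S \<le> vec.dim (vec.span (insert x ?K))"
    by (rule vec.dim_subset)
  also have "\<dots> = vec.dim (insert x ?K)"
    by (rule vec.dim_span)
  also have "\<dots> \<le> vec.dim ?K + 1"
    unfolding vec.dim_insert by simp
  finally show ?thesis .
qed

text \<open>The vector \<open>b\<close> is the single negative member of an orthogonal basis: a vector orthogonal to it
  has no \<open>b\<close>-coordinate, so \<open>h x x\<close> is a nonnegative combination of the other diagonal values.\<close>

lemma negative_basis_vector:
  assumes "has_signature h r 1"
  obtains b where "Re (h b b) < 0" and "\<And>x. h x b = 0 \<Longrightarrow> 0 \<le> Re (h x x)"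
proof -
  obtain B where B: "vec.independent B" "vec.span B = UNIV"
    and orth: "\<And>b c. b \<in> B \<Longrightarrow> c \<in> B \<Longrightarrow> b \<noteq> c \<Longrightarrow> h b c = 0"
    and neg: "card {b \<in> B. Re (h b b) < 0} = 1"
    using assms unfolding has_signature_def by blast
  obtain b where b: "{b \<in> B. Re (h b b) < 0} = {b}"
    using neg card_1_singletonE by blast
  then have bB: "b \<in> B" and bneg: "Re (h b b) < 0" by auto
  have fin: "finite B" using B(1) by (rule vec.finiteI_independent)
  have "0 \<le> Re (h x x)" if x: "h x b = 0" for x
  proof -
    have "x \<in> vec.span B" using B(2) by simp
    then obtain a where a: "x = (\<Sum>c\<in>B. a c *s c)"
      unfolding vec.span_finite[OF fin] by auto
    have coord: "h x c = a c * h c c" if "c \<in> B" for c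
    proof -
      have "h x c = (\<Sum>d\<in>B. a d * h d c)"
        unfolding a by (simp add: form_sum_left form_scale_left)
      also have "\<dots> = (\<Sum>d\<in>B. if d = c then a c * h c c else 0)"
        by (rule sum.cong) (auto simp: orth that)
      also have "\<dots> = a c * h c c" using that fin by simp
      finally show ?thesis .
    qed
    have "h b b \<noteq> 0" using bneg by auto
    then have "a b = 0" using coord[OF bB] x by simp
    have "h x x = (\<Sum>c\<in>B. a c * h c x)"
      by (subst (1) a) (simp add: form_sum_left form_scale_left)
    also have "\<dots> = (\<Sum>c\<in>B. a c * cnj (a c) * h c c)"
    proof (rule sum.cong)
      fix c assume c: "c \<in> B"
      have "h c x = cnj (a c) * h c c"
        by (subst form_sym) (simp add: coord[OF c] form_self_real)
      then show "a c * h c x = a c * cnj (a c) * h c c" by simp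
    qed simp
    finally have "Re (h x x) = (\<Sum>c\<in>B. Re (a c * cnj (a c) * h c c))"
      by (simp only: Re_sum)
    moreover have "0 \<le> Re (a c * cnj (a c) * h c c)" if "c \<in> B" for c
    proof (cases "c = b")
      case True then show ?thesis using \<open>a b = 0\<close> by simp
    next
      case False
      then have "c \<notin> {b \<in> B. Re (h b b) < 0}" unfolding b by blast
      then have "0 \<le> Re (h c c)" using that by simp
      moreover have "Re (a c * cnj (a c) * h c c) = (cmod (a c))\<^sup>2 * Re (h c c)"
        unfolding complex_norm_square[symmetric] by (simp del: of_real_power)
      ultimately show ?thesis by simp
    qed
    ultimately show ?thesis by (simp only: sum_nonneg)
  qed
  then show ?thesis using that bneg by blast
qed

text \<open>Otherwise \<open>p\<close> and \<open>v\<close> would span a negative definite plane, and such a plane contains a nonzero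
  vector orthogonal to the negative basis vector.\<close>

lemma orthogonal_to_negative_nonneg:
  assumes "has_signature h r 1" and p: "Re (h p p) < 0" and vp: "h v p = 0"
  shows "0 \<le> Re (h v v)"
proof (rule ccontr)
  assume "\<not> 0 \<le> Re (h v v)"
  then have v: "Re (h v v) < 0" by simp
  obtain b where pos: "\<And>x. h x b = 0 \<Longrightarrow> 0 \<le> Re (h x x)"
    using negative_basis_vector[OF assms(1)] by blast
  define x where "x = h v b *s p - h p b *s v"
  have pv: "h p v = 0" using vp using form_sym[of p v] by simp
  have "h x b = 0" unfolding x_def by (simp add: form_diff_left form_scale_left)
  then have "0 \<le> Re (h x x)" by (rule pos)
  moreover have "h x x = of_real ((cmod (h v b))\<^sup>2) * h p p + of_real ((cmod (h p b))\<^sup>2) * h v v"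
    unfolding x_def complex_norm_square
    by (simp add: form_diff_left form_diff_right form_scale_left form_scale_right vp pv)
  then have "Re (h x x) = (cmod (h v b))\<^sup>2 * Re (h p p) + (cmod (h p b))\<^sup>2 * Re (h v v)"
    by (simp del: of_real_power)
  moreover have "h p b \<noteq> 0" using pos[of p] p by auto
  then have "(cmod (h p b))\<^sup>2 * Re (h v v) < 0" using v by (simp add: mult_pos_neg)
  moreover have "(cmod (h v b))\<^sup>2 * Re (h p p) \<le> 0" using p by (simp add: mult_nonneg_nonpos)
  ultimately show False by linarith
qed

section \<open>Maps that are scalar on a line and on its orthogonal hyperplane\<close>

lemma A_map_fixes_line:
  assumes "h p p \<noteq> 0"
  shows "A_map h p \<zeta> p = p"
  using assms by (simp add: A_map_def line_projection_def flip: vec.scale_left_distrib)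

lemma A_map_on_orthogonal:
  assumes "h v p = 0"
  shows "A_map h p \<zeta> v = \<zeta> *s v"
  using assms by (simp add: A_map_def line_projection_def)

lemma linear_A_map: "Vector_Spaces.linear (*s) (*s) (A_map h p \<zeta>)"
proof (rule linear_vecI)
  show "A_map h p \<zeta> (u + v) = A_map h p \<zeta> u + A_map h p \<zeta> v" for u v
    by (simp add: A_map_def line_projection_def form_add_left vec_eq_iff algebra_simps add_divide_distrib)
  show "A_map h p \<zeta> (c *s v) = c *s A_map h p \<zeta> v" for c v
    by (simp add: A_map_def line_projection_def form_scale_left vec_eq_iff algebra_simps)
qed

lemma A_map_compose:
  assumes "h p p \<noteq> 0"
  shows "A_map h p \<zeta> (A_map h p \<eta> v) = A_map h p (\<zeta> * \<eta>) v"
  using assms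
  by (simp add: A_map_def line_projection_def form_simps vec_eq_iff)
    (simp add: field_simps)

lemma A_map_one: "A_map h p 1 v = v"
  by (simp add: A_map_def)

lemma A_map_preserves_form:
  assumes "h p p \<noteq> 0" "cmod \<zeta> = 1"
  shows "h (A_map h p \<zeta> u) (A_map h p \<zeta> v) = h u v"
proof -
  have z: "\<zeta> * cnj \<zeta> = 1"
    using assms(2) by (simp add: complex_norm_square[symmetric])
  have pv: "h p v = cnj (h v p)" by (rule form_sym)
  have "h (A_map h p \<zeta> u) (A_map h p \<zeta> v) =
     (\<zeta> * cnj \<zeta>) * h u v + (1 - \<zeta> * cnj \<zeta>) * (h u p * cnj (h v p) / h p p)"
    using assms(1)
    by (simp add: A_map_def line_projection_def form_simps pv form_self_real) (simp add: field_simps)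
  then show ?thesis by (simp add: z)
qed

text \<open>The inverse is the same kind of map, for \<open>cnj \<zeta>\<close>.\<close>

lemma A_map_unitary:
  assumes "h p p \<noteq> 0" "cmod \<zeta> = 1"
  shows "A_map h p \<zeta> \<in> carrier (unitary_group h)"
proof -
  have z: "\<zeta> * cnj \<zeta> = 1"
    using assms(2) by (simp add: complex_norm_square[symmetric])
  have "bij (A_map h p \<zeta>)"
    by (rule o_bij[where g = "A_map h p (cnj \<zeta>)"])
      (auto simp: fun_eq_iff A_map_compose[OF assms(1)] z mult.commute[of "cnj \<zeta>"] A_map_one)
  then show ?thesis
    using A_map_preserves_form[OF assms] linear_A_map by (simp add: unitary_group_def)
qed

text \<open>The map is diagonalised by a change of basis \<open>S\<close>. Choose a coordinate \<open>k\<close> in which \<open>p\<close> does not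
  vanish; \<open>S\<close> sends the \<open>k\<close>-th unit vector to \<open>p\<close> and every other unit vector to its component
  orthogonal to \<open>p\<close>. Nonvanishing of that coordinate is what makes \<open>S\<close> injective.\<close>

lemma det_scalar_on_line_and_hyperplane:
  fixes F :: "complex ^ 'm \<Rightarrow> complex ^ 'm"
  assumes lin: "Vector_Spaces.linear (*s) (*s) F" and hp: "h p p \<noteq> 0"
    and Fp: "F p = \<beta> *s p" and Forth: "\<And>v. h v p = 0 \<Longrightarrow> F v = \<alpha> *s v"
  shows "det (matrix F) = \<alpha> ^ (CARD('m) - 1) * \<beta>"
proof -
  have "p \<noteq> 0" using hp form_zero_left by auto
  then obtain k where k: "p $ k \<noteq> 0" by (auto simp: vec_eq_iff)
  define R where "R x = x - (x $ k) *s axis k 1" for x :: "complex ^ 'm"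
  define S where "S x = (R x - (h (R x) p / h p p) *s p) + (x $ k) *s p" for x
  define E :: "complex ^ 'm ^ 'm" where "E = (\<chi> i j. if i = j then (if i = k then \<beta> else \<alpha>) else 0)"
  have linS: "Vector_Spaces.linear (*s) (*s) S"
  proof (rule linear_vecI)
    have R_add: "R (x + y) = R x + R y" for x y
      by (simp add: R_def vec_eq_iff algebra_simps)
    have R_scale: "R (c *s x) = c *s R x" for c x
      by (simp add: R_def vec_eq_iff algebra_simps)
    show "S (x + y) = S x + S y" for x y
      unfolding S_def R_add form_add_left by (simp add: vec_eq_iff algebra_simps add_divide_distrib)
    show "S (c *s x) = c *s S x" for c x
      unfolding S_def R_scale form_scale_left by (simp add: vec_eq_iff algebra_simps)
  qed
  have orth: "h (R x - (h (R x) p / h p p) *s p) p = 0" for x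
    using hp by (simp add: form_diff_left form_scale_left)
  have E: "E *v x = \<alpha> *s R x + (\<beta> * x $ k) *s axis k 1" for x
    by (simp add: E_def R_def vec_eq_iff matrix_vector_mult_def axis_def if_distrib[of "\<lambda>z. z * _"]
        cong: if_cong)
  have Ek: "(E *v x) $ k = \<beta> * x $ k" for x
    unfolding E by (simp add: R_def axis_def)
  have ER: "R (E *v x) = \<alpha> *s R x" for x
    unfolding R_def[of "E *v x"] Ek unfolding E by simp
  have FS: "F (S x) = S (E *v x)" for x
  proof -
    have "F (S x) = \<alpha> *s (R x - (h (R x) p / h p p) *s p) + (x $ k) *s (\<beta> *s p)"
      unfolding S_def vec.linear_add[OF lin] vec.linear_scale[OF lin] Fp Forth[OF orth] ..
    also have "\<dots> = S (E *v x)"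
      unfolding S_def ER Ek form_scale_left by (simp add: vec_eq_iff algebra_simps)
    finally show ?thesis .
  qed
  have "inj S"
    unfolding vec.linear_inj_iff_eq_0[OF linS]
  proof (intro allI impI)
    fix x assume Sx: "S x = 0"
    have "h (S x) p = x $ k * h p p"
      unfolding S_def form_add_left orth by (simp add: form_scale_left)
    then have xk: "x $ k = 0" using Sx hp form_zero_left by simp
    then have Rx: "R x = x" by (simp add: R_def)
    have x: "x = (h x p / h p p) *s p"
      using Sx by (simp add: S_def Rx xk)
    then have "(h x p / h p p) * p $ k = 0"
      using xk by (metis vector_smult_component)
    then have "h x p / h p p = 0" using k by simp
    then show "x = 0" using x by (metis vec.scale_zero_left)
  qed
  then have "inj ((*v) (matrix S))"
    using matrix_works[OF linS] by (simp add: inj_def)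
  then have detS: "det (matrix S) \<noteq> 0"
    by (simp add: invertible_det_nz[symmetric] invertible_left_inverse matrix_left_invertible_injective)
  have "matrix F ** matrix S = matrix S ** E"
    unfolding matrix_eq
    by (simp add: matrix_vector_mul_assoc[symmetric] matrix_works[OF lin] matrix_works[OF linS] FS)
  then have "det (matrix F) * det (matrix S) = det (matrix S) * det E"
    by (metis det_mul)
  then have "det (matrix F) = det E" using detS by simp
  also have "\<dots> = (\<Prod>i\<in>UNIV. if i = k then \<beta> else \<alpha>)"
    unfolding E_def by (subst det_diagonal) auto
  also have "\<dots> = \<alpha> ^ (CARD('m) - 1) * \<beta>"
    by (simp add: prod.remove[of UNIV k] card_Diff_singleton)
  finally show ?thesis .
qed

section \<open>Products of three unitary involutions\<close>

text \<open>The identity is included, so that short words can be padded to length three.\<close>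

definition unitary_involution :: "(complex ^ 'm \<Rightarrow> complex ^ 'm) \<Rightarrow> bool" where
  "unitary_involution U \<longleftrightarrow> U \<in> carrier (unitary_group h) \<and> (\<forall>v. U (U v) = v)"

lemma unitary_involutionD:
  assumes "unitary_involution U"
  shows "Vector_Spaces.linear (*s) (*s) U" "h (U u) (U v) = h u v" "U (U v) = v"
  using assms by (auto simp: unitary_involution_def unitary_group_def)

lemma det_unitary_involution:
  assumes "unitary_involution U"
  shows "(det (matrix U))\<^sup>2 = 1"
proof -
  note U = unitary_involutionD[OF assms]
  have "matrix U ** matrix U = mat 1"
    unfolding matrix_eq by (simp add: matrix_vector_mul_assoc[symmetric] matrix_works[OF U(1)] U(3))
  then show ?thesis by (metis det_mul det_I power2_eq_square)
qed

lemma three_involutions_scalar_determinant: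
  assumes U: "unitary_involution U1" "unitary_involution U2" "unitary_involution U3"
    and prod: "\<And>v. U1 (U2 (U3 v)) = \<mu> *s A_map h p \<zeta> v" and hp: "h p p \<noteq> 0"
  shows "((\<mu> * \<zeta>) ^ (CARD('m) - 1) * \<mu>)\<^sup>2 = 1"
proof -
  note l = U[THEN unitary_involutionD(1)]
  let ?F = "\<lambda>v. \<mu> *s A_map h p \<zeta> v"
  have linF: "Vector_Spaces.linear (*s) (*s) ?F"
    using linear_A_map by (rule vec.linear_compose_scale_right)
  have "matrix U1 ** (matrix U2 ** matrix U3) = matrix ?F"
    unfolding matrix_eq
    by (simp add: matrix_vector_mul_assoc[symmetric] matrix_works[OF linF] matrix_works[OF l(1)]
        matrix_works[OF l(2)] matrix_works[OF l(3)] prod)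
  then have "det (matrix ?F) = det (matrix U1) * (det (matrix U2) * det (matrix U3))"
    by (metis det_mul)
  then have "(det (matrix ?F))\<^sup>2 = 1"
    by (simp add: power_mult_distrib det_unitary_involution[OF U(1)]
        det_unitary_involution[OF U(2)] det_unitary_involution[OF U(3)])
  moreover have "det (matrix ?F) = (\<mu> * \<zeta>) ^ (CARD('m) - 1) * \<mu>"
    by (rule det_scalar_on_line_and_hyperplane[OF linF hp])
      (simp_all add: A_map_fixes_line[OF hp] A_map_on_orthogonal)
  ultimately show ?thesis by simp
qed

text \<open>With \<open>N\<close> the dimension, the subspaces \<open>T\<close> and \<open>U1 T\<close> have dimension at least \<open>N - 2\<close> and meet
  only in zero, so they span everything because \<open>2 * (N - 2) \<ge> N\<close> when \<open>N \<ge> 4\<close>.\<close>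

lemma three_involutions_scalar_fourth_power:
  assumes U: "unitary_involution U1" "unitary_involution U2" "unitary_involution U3"
    and prod: "\<And>v. U1 (U2 (U3 v)) = \<mu> *s A_map h p \<zeta> v"
    and sig: "has_signature h r 1" and p: "Re (h p p) < 0" and card: "CARD('m) \<ge> 4"
    and norm: "cmod \<mu> = 1" "cmod \<zeta> = 1"
  shows "(\<mu> * \<zeta>) ^ 4 = 1"
proof (rule ccontr)
  assume ne: "(\<mu> * \<zeta>) ^ 4 \<noteq> 1"
  note U1 = unitary_involutionD[OF U(1)]
  note U2 = unitary_involutionD[OF U(2)]
  note U3 = unitary_involutionD[OF U(3)]
  define c where "c = (\<mu> * \<zeta>)\<^sup>2"
  have cc: "c * cnj c = 1"
    unfolding complex_norm_square[symmetric] by (simp add: c_def norm norm_mult norm_power)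
  have c2: "c * c \<noteq> 1"
    using ne by (simp add: c_def flip: power_add power2_eq_square)
  define M where "M = (\<lambda>v. U1 (U2 v))"
  have M_scale: "M (a *s v) = a *s M v" for a v
    by (simp add: M_def vec.linear_scale[OF U1(1)] vec.linear_scale[OF U2(1)])
  have M_form: "h (M u) (M v) = h u v" for u v
    by (simp add: M_def U1(2) U2(2))
  define T where "T = {v. h v p = 0 \<and> h v (U3 p) = 0}"
  define T' where "T' = U1 ` T"
  have M2T: "M (M v) = c *s v" if "v \<in> T" for v
  proof -
    have U3T: "U3 w \<in> T" if "w \<in> T" for w
      using that U3(2)[of w p] U3(2)[of w "U3 p"] U3(3) by (simp add: T_def)
    have M: "M w = (\<mu> * \<zeta>) *s U3 w" if "w \<in> T" for w
    proof -
      have "M w = \<mu> *s A_map h p \<zeta> (U3 w)"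
        using prod[of "U3 w"] by (simp add: M_def U3(3))
      also have "A_map h p \<zeta> (U3 w) = \<zeta> *s U3 w"
        using U3T[OF that] by (intro A_map_on_orthogonal) (simp add: T_def)
      finally show ?thesis by simp
    qed
    show ?thesis
      using M[OF that] M[OF U3T[OF that]] by (simp add: M_scale U3(3) c_def power2_eq_square)
  qed
  \<comment> \<open>From \<open>M U1 M = U1\<close>, the square of \<open>M\<close> acts on \<open>U1 T\<close> as the inverse of the scalar \<open>c\<close>.\<close>
  have M2T': "M (M w) = cnj c *s w" if w: "w \<in> T'" for w
  proof -
    obtain v where v: "v \<in> T" "w = U1 v" using w by (auto simp: T'_def)
    have MUM: "M (U1 (M x)) = U1 x" for x
      by (simp add: M_def U1(3) U2(3))
    have "U1 v = M (M (U1 (M (M v))))" by (simp add: MUM)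
    also have "\<dots> = c *s M (M (U1 v))"
      by (simp add: M2T[OF v(1)] vec.linear_scale[OF U1(1)] M_scale)
    finally have "cnj c *s U1 v = cnj c *s (c *s M (M (U1 v)))"
      by (rule arg_cong[where f = "\<lambda>x. cnj c *s x"])
    also have "\<dots> = M (M (U1 v))"
      by (simp only: vector_smult_assoc mult.commute[of "cnj c"] cc vector_smult_lid)
    finally show ?thesis by (simp add: v(2))
  qed
  \<comment> \<open>Moving \<open>M\<^sup>2\<close> through the form multiplies by \<open>c * cnj (cnj c) = c * c\<close>.\<close>
  have orth: "h v w = 0" if "v \<in> T" "w \<in> T'" for v w
  proof -
    have "h v w = h (M (M v)) (M (M w))" by (simp add: M_form)
    also have "\<dots> = (c * c) * h v w" by (simp add: M2T M2T' that form_simps)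
    finally have "h v w = 0 \<or> c * c = 1" by (simp only: mult_cancel_right1)
    then show ?thesis using c2 by blast
  qed
  have sT: "vec.subspace T"
    using subspace_form_kernel[OF subspace_form_kernel[OF vec.subspace_UNIV, of p], of "U3 p"]
    by (simp add: T_def)
  have sT': "vec.subspace T'"
    unfolding T'_def by (rule vec.linear_subspace_image[OF U1(1) sT])
  have dimU: "vec.dim (UNIV :: (complex ^ 'm) set) = CARD('m)"
    by (simp add: card_cart_basis)
  have "vec.dim (UNIV :: (complex ^ 'm) set) \<le> vec.dim {v. h v p = 0} + 1"
    using dim_form_kernel[OF vec.subspace_UNIV, of p] by simp
  moreover have "vec.dim {v. h v p = 0} \<le> vec.dim T + 1"
    using dim_form_kernel[OF subspace_form_kernel[OF vec.subspace_UNIV, of p], of "U3 p"]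
    by (simp add: T_def)
  ultimately have dimT: "CARD('m) \<le> vec.dim T + 2" using dimU by linarith
  have "inj U1" by (rule inj_on_inverseI[where g = U1]) (rule U1(3))
  then have "inj_on U1 (vec.span T)" by (rule inj_on_subset) (rule subset_UNIV)
  then have dimT': "vec.dim T' = vec.dim T"
    unfolding T'_def by (rule vec.dim_image_eq[OF U1(1)])
  have "T \<inter> T' \<subseteq> {0}"
  proof
    fix v assume v: "v \<in> T \<inter> T'"
    then have "c *s v = cnj c *s v" using M2T M2T' by (metis IntE)
    then have "c = cnj c \<or> v = 0" by (simp only: vec.scale_cancel_right)
    moreover have "c \<noteq> cnj c" using cc c2 by metis
    ultimately show "v \<in> {0}" by blast
  qed
  then have "vec.dim (T \<inter> T') = 0" by simp
  then have "vec.dim {x + y |x y. x \<in> T \<and> y \<in> T'} = 2 * vec.dim T"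
    using vec.dim_sums_Int[OF sT sT'] dimT' by linarith
  then have "vec.dim (UNIV :: (complex ^ 'm) set) \<le> vec.dim {x + y |x y. x \<in> T \<and> y \<in> T'}"
    using dimU dimT card by linarith
  then have "{x + y |x y. x \<in> T \<and> y \<in> T'} = UNIV"
    by (intro vec.subspace_dim_equal[OF vec.subspace_sums[OF sT sT'] vec.subspace_UNIV]) auto
  then obtain x y where xy: "x \<in> T" "y \<in> T'" "p = x + y" by blast
  have "0 \<le> Re (h x x)"
    using xy(1) by (intro orthogonal_to_negative_nonneg[OF sig p]) (simp add: T_def)
  moreover have "0 \<le> Re (h y y)"
  proof -
    obtain v where v: "v \<in> T" "y = U1 v" using xy(2) by (auto simp: T'_def)
    then have "0 \<le> Re (h v v)"
      by (intro orthogonal_to_negative_nonneg[OF sig p]) (simp add: T_def)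
    then show ?thesis by (simp add: v U1(2))
  qed
  moreover have "h p p = h x x + h y y"
    using orth[OF xy(1,2)] form_sym[of x y] by (simp add: xy(3) form_simps)
  ultimately show False using p by simp
qed

lemma A_map_three_involutions:
  assumes U: "unitary_involution U1" "unitary_involution U2" "unitary_involution U3"
    and prod: "\<And>v. U1 (U2 (U3 v)) = \<mu> *s A_map h p \<zeta> v"
    and sig: "has_signature h r 1" and p: "Re (h p p) < 0" and card: "CARD('m) \<ge> 4"
    and norm: "cmod \<mu> = 1" "cmod \<zeta> = 1"
  shows "\<zeta> ^ 4 = 1"
proof -
  have nu: "(\<mu> * \<zeta>) ^ 4 = 1"
    by (rule three_involutions_scalar_fourth_power[OF assms])
  have hp: "h p p \<noteq> 0" using p by auto
  have "(((\<mu> * \<zeta>) ^ (CARD('m) - 1) * \<mu>)\<^sup>2)\<^sup>2 = ((\<mu> * \<zeta>) ^ 4) ^ (CARD('m) - 1) * \<mu> ^ 4"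
    by (simp add: power_mult_distrib flip: power_mult)
  then have "\<mu> ^ 4 = 1"
    unfolding three_involutions_scalar_determinant[OF U prod hp] nu by simp
  then show ?thesis using nu by (simp add: power_mult_distrib)
qed

section \<open>Lifting words of involutions from the projective unitary group\<close>

lemma scalar_unitary:
  assumes "U \<in> carrier (unitary_group h)" "cmod a = 1"
  shows "(\<lambda>v. a *s U v) \<in> carrier (unitary_group h)"
proof -
  have aa: "a * cnj a = 1" "a \<noteq> 0"
    using assms(2) by (auto simp: complex_norm_square[symmetric])
  have U: "Vector_Spaces.linear (*s) (*s) U" "bij U" "\<And>u v. h (U u) (U v) = h u v"
    using assms(1) by (auto simp: unitary_group_def)
  have "bij (\<lambda>v :: complex ^ 'm. a *s v)"
    by (rule o_bij[where g = "\<lambda>v. inverse a *s v"]) (auto simp: fun_eq_iff aa)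
  from bij_comp[OF U(2) this] have "bij (\<lambda>v. a *s U v)" by (simp add: o_def)
  moreover have "h (a *s U u) (a *s U v) = h u v" for u v
  proof -
    have "h (a *s U u) (a *s U v) = (a * cnj a) * h (U u) (U v)"
      by (simp add: form_simps)
    then show ?thesis by (simp add: aa U(3))
  qed
  ultimately show ?thesis
    using vec.linear_compose_scale_right[OF U(1)] by (simp add: unitary_group_def)
qed

text \<open>A representative \<open>U\<close> has square \<open>exp (\<i> * t)\<close>; multiplying it by \<open>exp (- \<i> * t / 2)\<close> stays in the
  same class and makes the square the identity.\<close>

lemma involution_lift:
  assumes "x \<in> involutions (projective_unitary_group h)"
  shows "\<exists>U\<in>x. unitary_involution U"
proof -
  have carr: "x \<in> carrier (projective_unitary_group h)"
    and sq: "x \<otimes>\<^bsub>projective_unitary_group h\<^esub> x = \<one>\<^bsub>projective_unitary_group h\<^esub>"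
    using assms by (auto simp: involutions_def)
  obtain U where U: "U \<in> carrier (unitary_group h)" and x: "x = unit_scalars #>\<^bsub>unitary_group h\<^esub> U"
    using carr by (auto simp: projective_unitary_group_def FactGroup_def RCOSETS_def)
  have x': "x = {s \<circ> U | s. s \<in> unit_scalars}"
    unfolding x by (auto simp: r_coset_def unitary_group_def)
  have scal: "(\<lambda>v. exp (\<i> * of_real t) *s v) \<in> (unit_scalars :: (complex ^ 'm \<Rightarrow> _) set)" for t
    unfolding unit_scalars_def by blast
  have "U \<in> x" using scal[of 0] unfolding x' by (force simp: fun_eq_iff)
  then have "U \<circ> U \<in> x \<otimes>\<^bsub>projective_unitary_group h\<^esub> x"
    by (auto simp: projective_unitary_group_def FactGroup_def set_mult_def unitary_group_def)
  also have "\<dots> = unit_scalars" unfolding sq by (simp add: projective_unitary_group_def FactGroup_def)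
  finally obtain t where t: "U \<circ> U = (\<lambda>v. exp (\<i> * of_real t) *s v)"
    unfolding unit_scalars_def by blast
  define a where "a = exp (\<i> * of_real (- t / 2))"
  define U' where "U' = (\<lambda>v. a *s U v)"
  have "U' \<in> x"
    unfolding x' using scal[of "- t / 2"] by (force simp: U'_def a_def fun_eq_iff)
  moreover have "U' (U' v) = v" for v
  proof -
    have lin: "Vector_Spaces.linear (*s) (*s) U" using U by (simp add: unitary_group_def)
    have "U' (U' v) = (a * a * exp (\<i> * of_real t)) *s v"
      using fun_cong[OF t, of v] by (simp add: U'_def vec.linear_scale[OF lin])
    also have "a * a * exp (\<i> * of_real t) = 1"
      by (simp add: a_def flip: exp_add)
    finally show ?thesis by simp
  qed
  moreover have "U' \<in> carrier (unitary_group h)"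
    unfolding U'_def by (rule scalar_unitary[OF U]) (simp add: a_def)
  ultimately show ?thesis by (auto simp: unitary_involution_def)
qed

text \<open>Multiplication and unit of the quotient are the set product and the subgroup of scalars, so a
  product of representatives lies in the product of the classes by definition.\<close>

lemma involution_word_lift:
  assumes "set xs \<subseteq> involutions (projective_unitary_group h)"
  shows "\<exists>Us. length Us = length xs \<and> (\<forall>U\<in>set Us. unitary_involution U) \<and>
    foldr (\<circ>) Us id \<in> foldr (\<lambda>x y. x \<otimes>\<^bsub>projective_unitary_group h\<^esub> y) xs \<one>\<^bsub>projective_unitary_group h\<^esub>"
  using assms
proof (induction xs)
  case Nil
  have "id \<in> \<one>\<^bsub>projective_unitary_group h\<^esub>"
    by (auto simp: projective_unitary_group_def FactGroup_def unit_scalars_def fun_eq_iff intro!: exI[of _ 0])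
  then show ?case by (intro exI[of _ "[]"]) (simp add: id_def)
next
  case (Cons x xs)
  then have "set xs \<subseteq> involutions (projective_unitary_group h)" by simp
  from Cons.IH[OF this] obtain Us where Us: "length Us = length xs" "\<forall>U\<in>set Us. unitary_involution U"
    "foldr (\<circ>) Us id \<in> foldr (\<lambda>x y. x \<otimes>\<^bsub>projective_unitary_group h\<^esub> y) xs \<one>\<^bsub>projective_unitary_group h\<^esub>"
    by blast
  obtain U where U: "U \<in> x" "unitary_involution U"
    using involution_lift Cons.prems by auto
  have mult: "f \<circ> g \<in> X \<otimes>\<^bsub>projective_unitary_group h\<^esub> Y" if "f \<in> X" "g \<in> Y" for f g X Y
    using that by (auto simp: projective_unitary_group_def FactGroup_def set_mult_def unitary_group_def)
  have "foldr (\<circ>) (U # Us) id \<in>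
      foldr (\<lambda>x y. x \<otimes>\<^bsub>projective_unitary_group h\<^esub> y) (x # xs) \<one>\<^bsub>projective_unitary_group h\<^esub>"
    using mult[OF U(1) Us(3)] by (simp only: foldr_Cons o_apply)
  moreover have "length (U # Us) = length (x # xs)" "\<forall>V\<in>set (U # Us). unitary_involution V"
    using Us(1,2) U(2) by simp_all
  ultimately show ?case by blast
qed

lemma unitary_involution_id: "unitary_involution id"
  by (simp add: unitary_involution_def unitary_group_def vec.linear_id)

lemma short_word_padding:
  assumes "length Us \<le> 3" "\<forall>U\<in>set Us. unitary_involution U"
  shows "\<exists>U1 U2 U3. unitary_involution U1 \<and> unitary_involution U2 \<and> unitary_involution U3 \<and>
    foldr (\<circ>) Us id = U1 \<circ> U2 \<circ> U3"
proof -
  define Vs where "Vs = Us @ replicate (3 - length Us) id"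
  have pad: "((\<circ>) id ^^ k) id = (id :: complex ^ 'm \<Rightarrow> complex ^ 'm)" for k
    by (induction k) auto
  have "length Vs = 3" using assms(1) by (simp add: Vs_def)
  then obtain U1 U2 U3 where Vs: "Vs = [U1, U2, U3]"
    by (auto simp: numeral_3_eq_3 length_Suc_conv)
  have "\<forall>U\<in>set Vs. unitary_involution U"
    using assms(2) unitary_involution_id by (auto simp: Vs_def)
  moreover have "foldr (\<circ>) Us id = foldr (\<circ>) Vs id"
    by (simp add: Vs_def pad)
  ultimately show ?thesis
    by (intro exI[of _ U1] exI[of _ U2] exI[of _ U3]) (simp add: Vs comp_assoc)
qed

lemma A_map_length_ge_4:
  assumes sig: "has_signature h r 1" and p: "Re (h p p) < 0" and card: "CARD('m) \<ge> 4"
    and norm: "cmod \<zeta> = 1" and \<zeta>: "\<zeta> ^ 4 \<noteq> 1"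
  shows "involution_length (projective_unitary_group h) (proj_class h (A_map h p \<zeta>)) \<ge> 4"
  unfolding involution_length_def
proof (rule Inf_greatest, clarify)
  fix xs
  assume xs: "set xs \<subseteq> involutions (projective_unitary_group h)"
    and eq: "proj_class h (A_map h p \<zeta>) =
      foldr (\<lambda>x y. x \<otimes>\<^bsub>projective_unitary_group h\<^esub> y) xs \<one>\<^bsub>projective_unitary_group h\<^esub>"
  have "\<not> length xs \<le> 3"
  proof
    assume "length xs \<le> 3"
    then obtain U1 U2 U3 where
      U: "unitary_involution U1" "unitary_involution U2" "unitary_involution U3" and
      mem: "U1 \<circ> U2 \<circ> U3 \<in> proj_class h (A_map h p \<zeta>)"
      using involution_word_lift[OF xs] short_word_padding unfolding eq by metis
    obtain t where "U1 \<circ> U2 \<circ> U3 = (\<lambda>v. exp (\<i> * of_real t) *s v) \<circ> A_map h p \<zeta>"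
      using mem by (auto simp: proj_class_def r_coset_def unitary_group_def unit_scalars_def)
    then have "U1 (U2 (U3 v)) = exp (\<i> * of_real t) *s A_map h p \<zeta> v" for v
      by (simp add: fun_eq_iff)
    from A_map_three_involutions[OF U this sig p card _ norm] \<zeta>
    show False by simp
  qed
  then have "4 \<le> length xs" by simp
  then show "4 \<le> enat (length xs)" by (simp add: numeral_eq_enat)
qed

lemma proj_class_in_carrier:
  assumes "U \<in> carrier (unitary_group h)"
  shows "proj_class h U \<in> carrier (projective_unitary_group h)"
  using assms by (auto simp: proj_class_def projective_unitary_group_def FactGroup_def RCOSETS_def)

end

theorem corollary3p4:
  fixes h :: "complex ^ 'm \<Rightarrow> complex ^ 'm \<Rightarrow> complex" and n :: nat
  assumes "n \<ge> 3" and "CARD('m) = n + 1"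
    and "hermitian_form h" and "nondegenerate_form h" and "has_signature h n 1"
  shows "(\<forall>p. Re (h p p) < 0 \<longrightarrow>
            involution_length (projective_unitary_group h)
              (proj_class h (A_map h p (exp (\<i> * of_real pi / 3)))) \<ge> 4) \<and>
         group_involution_length (projective_unitary_group h) \<ge> 4"
proof -
  let ?G = "projective_unitary_group h"
  define \<zeta> where "\<zeta> = exp (\<i> * of_real pi / 3)"
  have cis: "\<zeta> = cis (pi / 3)" by (simp add: \<zeta>_def cis_conv_exp)
  have norm: "cmod \<zeta> = 1" by (simp add: cis)
  have "\<zeta> ^ 4 = cis (real 4 * (pi / 3))"
    unfolding cis by (rule Complex.DeMoivre)
  also have "real 4 * (pi / 3) = pi + pi / 3" by simp
  finally have "Re (\<zeta> ^ 4) = cos (pi + pi / 3)" by simp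
  also have "\<dots> = - (1 / 2)" unfolding cos_periodic_pi2 cos_60 ..
  finally have "\<zeta> ^ 4 \<noteq> 1" by auto
  then have len: "4 \<le> involution_length ?G (proj_class h (A_map h p \<zeta>))" if "Re (h p p) < 0" for p
    using A_map_length_ge_4[OF assms(3,5) that _ norm] assms(1,2) by simp
  obtain p where p: "Re (h p p) < 0"
    using negative_basis_vector[OF assms(3,5)] by blast
  then have "h p p \<noteq> 0" by auto
  then have "proj_class h (A_map h p \<zeta>) \<in> carrier ?G"
    by (intro proj_class_in_carrier A_map_unitary assms norm)
  then have "4 \<le> group_involution_length ?G"
    unfolding group_involution_length_def using len[OF p] by (rule SUP_upper2)
  then show ?thesis using len unfolding \<zeta>_def by blast
qed

end
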